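(* Fix $\sigma>\frac52$ and let $V=\{V_n\}_{n\in\mathbb Z}$ be a real-valued sequence with $V\in l^1_{2\sigma-1}$. Let $H=-\Delta+V$ on $l^2(\mathbb Z)$. Assume that $V$ is generic in the sense that for no $s$ with $\frac12<s\le\frac32$ does there exist a nonzero solution $\psi_0\in l^2_{-s}$ of $(-\Delta+V)\psi_0=0$. Then the discrete spectrum of $H$ is finite-dimensional (it consists of finitely many eigenvalues, each of finite multiplicity) and is located in $(\omega_{\min},0)\cup(4,\omega_{\max})$, where $$\omega_{\min}=\min_{n\in\mathbb Z}\{0,V_n\},\qquad \omega_{\max}=\max_{n\in\mathbb Z}\{4,4+V_n\}.$$
   Context: For a sequence $\phi$ on $\mathbb Z$, $(-\Delta\phi)_n=-(\phi_{n+1}+\phi_{n-1}-2\phi_n)$ and $(V\phi)_n=V_n\phi_n$. For $\sigma\in\mathbb R$, $l^2_\sigma$ is the space of complex sequences on $\mathbb Z$ with $\|u\|_{l^2_\sigma}=\left(\sum_{n}(1+n^2)^{\sigma}|u_n|^2\right)^{1/2}<\infty$, and $l^1_\sigma$ is the space with $\|u\|_{l^1_\sigma}=\sum_{n}(1+n^2)^{\sigma/2}|u_n|<\infty$. $H$ is a bounded self-adjoint operator on $l^2(\mathbb Z)$. Here $\min_{n}\{0,V_n\}$ means the minimum of the set $\{0\}\cup\{V_n:n\in\mathbb Z\}$, and similarly for the maximum; an interval $(a,a)$ is empty. *)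

theory Defs
  imports "HOL-Analysis.Analysis" "HOL-Library.Function_Algebras"
begin

definition weighted_l2 :: "real \<Rightarrow> (int \<Rightarrow> complex) set" where
  "weighted_l2 \<sigma> =
     {u. (\<lambda>n. (1 + (real_of_int n)\<^sup>2) powr \<sigma> * (cmod (u n))\<^sup>2) summable_on UNIV}"

definition weighted_l2_norm :: "real \<Rightarrow> (int \<Rightarrow> complex) \<Rightarrow> real" where
  "weighted_l2_norm \<sigma> u =
     sqrt (\<Sum>\<^sub>\<infinity>n. (1 + (real_of_int n)\<^sup>2) powr \<sigma> * (cmod (u n))\<^sup>2)"

definition weighted_l1 :: "real \<Rightarrow> (int \<Rightarrow> complex) set" where
  "weighted_l1 \<sigma> =
     {u. (\<lambda>n. (1 + (real_of_int n)\<^sup>2) powr (\<sigma> / 2) * cmod (u n)) summable_on UNIV}"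

abbreviation l2 :: "(int \<Rightarrow> complex) set" where
  "l2 \<equiv> weighted_l2 0"

abbreviation l2_norm :: "(int \<Rightarrow> complex) \<Rightarrow> real" where
  "l2_norm \<equiv> weighted_l2_norm 0"

definition scale_seq :: "complex \<Rightarrow> (int \<Rightarrow> complex) \<Rightarrow> int \<Rightarrow> complex" where
  "scale_seq c u = (\<lambda>n. c * u n)"

global_interpretation cseq: vector_space scale_seq
  by unfold_locales (auto simp: scale_seq_def fun_eq_iff algebra_simps)

definition finite_dimensional :: "(int \<Rightarrow> complex) set \<Rightarrow> bool" where
  "finite_dimensional E \<longleftrightarrow> (\<exists>B. finite B \<and> E \<subseteq> cseq.span B)"

definition neg_laplacian :: "(int \<Rightarrow> complex) \<Rightarrow> int \<Rightarrow> complex" where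
  "neg_laplacian \<phi> = (\<lambda>n. - (\<phi> (n + 1) + \<phi> (n - 1) - 2 * \<phi> n))"

definition schroedinger :: "(int \<Rightarrow> real) \<Rightarrow> (int \<Rightarrow> complex) \<Rightarrow> int \<Rightarrow> complex" where
  "schroedinger V \<phi> = (\<lambda>n. neg_laplacian \<phi> n + complex_of_real (V n) * \<phi> n)"

(* The argument A of the following notions is defined on all sequences;
   it is regarded as an operator on l2 by restricting it to l2. *)

definition resolvent_set :: "((int \<Rightarrow> complex) \<Rightarrow> int \<Rightarrow> complex) \<Rightarrow> complex set" where
  "resolvent_set A =
     {z. bij_betw (\<lambda>u. A u - scale_seq z u) l2 l2 \<and>
         (\<exists>C. \<forall>u\<in>l2. l2_norm u \<le> C * l2_norm (A u - scale_seq z u))}"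

definition spectrum :: "((int \<Rightarrow> complex) \<Rightarrow> int \<Rightarrow> complex) \<Rightarrow> complex set" where
  "spectrum A = - resolvent_set A"

definition eigenspace :: "((int \<Rightarrow> complex) \<Rightarrow> int \<Rightarrow> complex) \<Rightarrow> complex \<Rightarrow> (int \<Rightarrow> complex) set" where
  "eigenspace A z = {u \<in> l2. A u = scale_seq z u}"

definition is_eigenvalue :: "((int \<Rightarrow> complex) \<Rightarrow> int \<Rightarrow> complex) \<Rightarrow> complex \<Rightarrow> bool" where
  "is_eigenvalue A z \<longleftrightarrow> (\<exists>u\<in>eigenspace A z. u \<noteq> 0)"

(* Eigenvalues of finite multiplicity that are isolated points of the spectrum; the geometric
   multiplicity is the right one because this is applied to self-adjoint operators only. *)
definition discrete_spectrum :: "((int \<Rightarrow> complex) \<Rightarrow> int \<Rightarrow> complex) \<Rightarrow> complex set" where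
  "discrete_spectrum A =
     {z. z isolated_in spectrum A \<and> is_eigenvalue A z \<and> finite_dimensional (eigenspace A z)}"

definition generic_potential :: "(int \<Rightarrow> real) \<Rightarrow> bool" where
  "generic_potential V \<longleftrightarrow>
     \<not> (\<exists>s \<psi>. 1/2 < s \<and> s \<le> 3/2 \<and> \<psi> \<in> weighted_l2 (- s) \<and> \<psi> \<noteq> 0 \<and> schroedinger V \<psi> = 0)"

(* The minimum and maximum are attained whenever V tends to 0 at infinity. *)

definition omega_min :: "(int \<Rightarrow> real) \<Rightarrow> real" where
  "omega_min V = (LEAST x. x \<in> {0} \<union> range V)"

definition omega_max :: "(int \<Rightarrow> real) \<Rightarrow> real" where
  "omega_max V = (GREATEST x. x \<in> {4} \<union> range (\<lambda>n. 4 + V n))"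

end

theory Submission imports Defs begin

text \<open>
  Summation by parts gives \<open>\<langle>u, H u\<rangle> = \<Sum> \<bar>u (n + 1) - u n\<bar>\<^sup>2 + \<Sum> V n \<bar>u n\<bar>\<^sup>2\<close>. Hence eigenvalues are real
  and exceed every lower bound of \<open>V\<close>; the inequality is strict because a square summable
  sequence with vanishing differences is zero. Truncated plane waves, translated to where \<open>V\<close> is
  small, are approximate eigenvectors for every energy in \<open>[0, 4]\<close>, so no point of this interval is
  isolated in the spectrum.

  For finiteness below \<open>0\<close>, choose a finite set \<open>F\<close> off which \<open>\<Sum> \<bar>n\<bar> \<bar>V n\<bar> \<le> 1\<close>. If \<open>u\<close> vanishes on
  \<open>F \<union> {0}\<close>, then \<open>\<bar>u n\<bar>\<^sup>2 \<le> \<bar>n\<bar> \<Sum> \<bar>u (i + 1) - u i\<bar>\<^sup>2\<close> makes the quadratic form nonnegative at \<open>u\<close>,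
  whereas it is negative at every nonzero vector of the span of the eigenspaces with negative
  eigenvalue. So restriction to \<open>F \<union> {0}\<close> is injective on that span. The part above \<open>4\<close> reduces to the
  part below \<open>0\<close> because conjugation by \<open>(-1)^n\<close> turns \<open>H\<close> into \<open>4\<close> minus the operator with
  potential \<open>- V\<close>.
\<close>

subsection \<open>Square summable sequences\<close>

lemma summable_on_small_tail:
  fixes f :: "'a \<Rightarrow> real"
  assumes "f summable_on UNIV" "0 < \<epsilon>"
  obtains F where "finite F" "infsum f (- F) \<le> \<epsilon>"
proof -
  obtain F where F: "finite F" "dist (sum f F) (infsum f UNIV) \<le> \<epsilon>"
    using infsum_finite_approximation[OF assms] by auto
  have "infsum f (- F) = infsum f UNIV - sum f F"
    using infsum_Diff[OF assms(1), of F] F(1) by (simp add: Compl_eq_Diff_UNIV)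
  with F show ?thesis
    using that[of F] by (simp add: dist_real_def)
qed

text \<open>Decay at infinity in the form used below: off the finite set \<open>F\<close> every term
  is bounded by the tail sum, which is at most \<open>\<epsilon> / 2\<close>.\<close>

lemma summable_on_finite_superlevel:
  fixes f :: "'a \<Rightarrow> real"
  assumes "f summable_on UNIV" "\<And>x. 0 \<le> f x" "0 < \<epsilon>"
  shows "finite {x. \<epsilon> \<le> f x}"
proof -
  obtain F where F: "finite F" "infsum f (- F) \<le> \<epsilon> / 2"
    using summable_on_small_tail[OF assms(1), of "\<epsilon> / 2"] assms(3) by auto
  have "f x < \<epsilon>" if "x \<notin> F" for x
  proof -
    have "sum f {x} \<le> infsum f (- F)"
      using that assms
      by (intro finite_sum_le_infsum summable_on_subset_banach[OF assms(1)]) auto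
    then show ?thesis
      using F(2) assms(3) by simp
  qed
  then have "{x. \<epsilon> \<le> f x} \<subseteq> F"
    by force
  then show ?thesis
    using F(1) finite_subset by blast
qed

lemma l2_iff: "u \<in> l2 \<longleftrightarrow> (\<lambda>n. (cmod (u n))\<^sup>2) summable_on UNIV"
proof -
  \<comment> \<open>\<open>powr 0\<close> equals 1 only for a nonzero base, so this fact is what
    removes the weight.\<close>
  have "1 + (real_of_int n)\<^sup>2 \<noteq> 0" for n
    using zero_le_power2[of "real_of_int n"] by linarith
  then show ?thesis
    by (simp add: weighted_l2_def)
qed

lemma l2_norm_eq: "l2_norm u = sqrt (\<Sum>\<^sub>\<infinity>n. (cmod (u n))\<^sup>2)"
proof -
  have "1 + (real_of_int n)\<^sup>2 \<noteq> 0" for n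
    using zero_le_power2[of "real_of_int n"] by linarith
  then show ?thesis
    by (simp add: weighted_l2_norm_def)
qed

lemma l2_dominated:
  assumes "u \<in> l2" "\<And>n. cmod (v n) \<le> c * cmod (u n)"
  shows "v \<in> l2"
proof -
  have s: "(\<lambda>n. c\<^sup>2 * (cmod (u n))\<^sup>2) summable_on UNIV"
    using assms(1) by (intro summable_on_cmult_right) (simp add: l2_iff)
  have "(cmod (v n))\<^sup>2 \<le> c\<^sup>2 * (cmod (u n))\<^sup>2" for n
    using power_mono[OF assms(2)[of n], of 2] by (simp add: power_mult_distrib)
  then show ?thesis
    unfolding l2_iff by (intro summable_on_comparison_test[OF s]) auto
qed

lemma l2_add:
  assumes "u \<in> l2" "v \<in> l2"
  shows "u + v \<in> l2"
proof -
  have s: "(\<lambda>n. 2 * (cmod (u n))\<^sup>2 + 2 * (cmod (v n))\<^sup>2) summable_on UNIV"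
    using assms by (intro summable_on_add summable_on_cmult_right) (simp_all add: l2_iff)
  have "(cmod (u n + v n))\<^sup>2 \<le> 2 * (cmod (u n))\<^sup>2 + 2 * (cmod (v n))\<^sup>2" for n
  proof -
    have "(cmod (u n + v n))\<^sup>2 \<le> (cmod (u n) + cmod (v n))\<^sup>2"
      by (intro power_mono norm_triangle_ineq) auto
    also have "\<dots> \<le> 2 * (cmod (u n))\<^sup>2 + 2 * (cmod (v n))\<^sup>2"
      using zero_le_power2[of "cmod (u n) - cmod (v n)"]
      by (simp add: power2_eq_square algebra_simps)
    finally show ?thesis .
  qed
  then show ?thesis
    unfolding l2_iff plus_fun_apply by (intro summable_on_comparison_test[OF s]) auto
qed

lemma l2_potential_summable:
  fixes V :: "int \<Rightarrow> real"
  assumes "bounded (range V)" "u \<in> l2"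
  shows "(\<lambda>n. V n * (cmod (u n))\<^sup>2) summable_on UNIV"
proof -
  obtain K where K: "\<And>n. \<bar>V n\<bar> \<le> K"
    using assms(1) by (auto simp: bounded_iff)
  have s: "(\<lambda>n. K * (cmod (u n))\<^sup>2) summable_on UNIV"
    using assms(2) by (intro summable_on_cmult_right) (simp add: l2_iff)
  show ?thesis
    by (rule abs_summable_summable[OF summable_on_comparison_test[OF s]])
      (simp_all add: abs_mult K mult_right_mono)
qed

lemma l2_zero: "0 \<in> l2"
  by (simp add: l2_iff)

lemma l2_scale: "u \<in> l2 \<Longrightarrow> scale_seq c u \<in> l2"
  by (erule l2_dominated[where c = "cmod c"]) (simp add: scale_seq_def norm_mult)

lemma l2_diff:
  assumes "u \<in> l2" "v \<in> l2"
  shows "u - v \<in> l2"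
proof -
  have "u - v = u + scale_seq (- 1) v"
    by (simp add: scale_seq_def fun_eq_iff)
  then show ?thesis
    using assms by (simp only: l2_add l2_scale)
qed

lemma subspace_l2: "cseq.subspace l2"
  by (simp add: cseq.subspace_def l2_add l2_zero l2_scale)

lemma l2_sum: "(\<And>x. x \<in> F \<Longrightarrow> f x \<in> l2) \<Longrightarrow> sum f F \<in> l2"
  by (rule cseq.subspace_sum[OF subspace_l2])

lemma bij_shift: "bij (\<lambda>n::int. n + k)"
  by (rule bij_betwI[where g = "\<lambda>n. n - k"]) auto

lemma l2_shift:
  assumes "u \<in> l2"
  shows "(\<lambda>n. u (n + k)) \<in> l2"
  using assms summable_on_reindex_bij_betw[OF bij_shift, of "\<lambda>n. (cmod (u n))\<^sup>2" k]
  by (simp add: l2_iff)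

lemma l2_multiplier:
  fixes V :: "int \<Rightarrow> real"
  assumes "bounded (range V)" "u \<in> l2"
  shows "(\<lambda>n. complex_of_real (V n) * u n) \<in> l2"
proof -
  obtain K where "\<And>n. \<bar>V n\<bar> \<le> K"
    using assms(1) by (auto simp: bounded_iff)
  then show ?thesis
    by (intro l2_dominated[OF assms(2), where c = K]) (simp add: norm_mult mult_right_mono)
qed

section \<open>The inner product, conjugate-linear in the first argument\<close>

definition ip :: "(int \<Rightarrow> complex) \<Rightarrow> (int \<Rightarrow> complex) \<Rightarrow> complex" where
  "ip u v = (\<Sum>\<^sub>\<infinity>n. cnj (u n) * v n)"

lemma ip_summable:
  assumes "u \<in> l2" "v \<in> l2"
  shows "(\<lambda>n. cnj (u n) * v n) summable_on UNIV"
proof -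
  have s: "(\<lambda>n. (cmod (u n))\<^sup>2 + (cmod (v n))\<^sup>2) summable_on UNIV"
    using assms by (intro summable_on_add) (simp_all add: l2_iff)
  have "norm (cnj (u n) * v n) \<le> (cmod (u n))\<^sup>2 + (cmod (v n))\<^sup>2" for n
  proof -
    have "2 * (cmod (u n) * cmod (v n)) \<le> (cmod (u n))\<^sup>2 + (cmod (v n))\<^sup>2"
      using zero_le_power2[of "cmod (u n) - cmod (v n)"]
      by (simp add: power2_eq_square algebra_simps)
    moreover have "0 \<le> cmod (u n) * cmod (v n)"
      by simp
    ultimately show ?thesis
      by (simp only: norm_mult complex_mod_cnj)
  qed
  then show ?thesis
    by (rule abs_summable_summable[OF summable_on_comparison_test[OF s]]) simp_all
qed

lemma ip_add_right:
  assumes "u \<in> l2" "v \<in> l2" "w \<in> l2"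
  shows "ip u (v + w) = ip u v + ip u w"
  using infsum_add[OF ip_summable[OF assms(1,2)] ip_summable[OF assms(1,3)]]
  by (simp add: ip_def distrib_left)

lemma ip_scale_right: "ip u (scale_seq c v) = c * ip u v"
  unfolding ip_def scale_seq_def
  by (simp add: infsum_cmult_right'[symmetric] mult.left_commute)

lemma ip_commute: "ip v u = cnj (ip u v)"
  unfolding ip_def by (simp add: infsum_cnj[symmetric] mult.commute del: infsum_cnj)

lemma ip_zero_right: "ip u 0 = 0"
  by (simp add: ip_def)

lemma ip_sum_right:
  assumes "finite F" "u \<in> l2" "\<And>x. x \<in> F \<Longrightarrow> f x \<in> l2"
  shows "ip u (sum f F) = (\<Sum>x\<in>F. ip u (f x))"
  using assms by (induction F) (simp_all add: ip_zero_right ip_add_right l2_sum)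

lemma ip_diff_right:
  assumes "u \<in> l2" "v \<in> l2" "w \<in> l2"
  shows "ip u (v - w) = ip u v - ip u w"
proof -
  have "v - w = v + scale_seq (- 1) w"
    by (simp add: scale_seq_def fun_eq_iff)
  then show ?thesis
    using assms by (simp only: ip_add_right ip_scale_right l2_scale) simp
qed

lemma ip_diff_left:
  assumes "u \<in> l2" "v \<in> l2" "w \<in> l2"
  shows "ip (v - w) u = ip v u - ip w u"
  using ip_diff_right[OF assms] by (metis complex_cnj_diff ip_commute)

text \<open>Summability is not assumed: a real family that is not summable stays so in the complex
  numbers, and both sums then have the default value 0.\<close>

lemma infsum_complex_of_real: "(\<Sum>\<^sub>\<infinity>x\<in>A. complex_of_real (f x)) = complex_of_real (infsum f A)"
proof (cases "f summable_on A")
  case True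
  then show ?thesis
    by (intro infsumI) (simp add: has_sum_of_real_iff)
next
  case False
  then have "\<not> (\<lambda>x. complex_of_real (f x)) summable_on A"
    using summable_on_Re by fastforce
  with False show ?thesis
    by (simp add: infsum_not_exists)
qed

lemma ip_self: "ip u u = complex_of_real (\<Sum>\<^sub>\<infinity>n. (cmod (u n))\<^sup>2)"
proof -
  have "cnj (u n) * u n = complex_of_real ((cmod (u n))\<^sup>2)" for n
    by (metis complex_norm_square mult.commute)
  then show ?thesis
    by (simp only: ip_def infsum_complex_of_real)
qed

lemma ip_self_nonneg: "0 \<le> Re (ip u u)"
  by (simp add: ip_self infsum_nonneg)

lemma ip_self_pos:
  assumes "u \<in> l2" "u \<noteq> 0"
  shows "0 < Re (ip u u)"
proof (rule ccontr)
  assume "\<not> ?thesis"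
  then have "(\<Sum>\<^sub>\<infinity>n. (cmod (u n))\<^sup>2) \<le> 0"
    by (simp add: ip_self)
  then have "(cmod (u n))\<^sup>2 = 0" for n
    by (rule nonneg_infsum_le_0D) (use assms in \<open>auto simp: l2_iff\<close>)
  then show False
    using assms(2) by (simp add: fun_eq_iff)
qed

lemma ip_shift: "ip (\<lambda>n. u (n + k)) (\<lambda>n. v (n + k)) = ip u v"
  using infsum_reindex_bij_betw[OF bij_shift, of "\<lambda>n. cnj (u n) * v n" k]
  by (simp add: ip_def)

subsection \<open>The quadratic form\<close>

definition fdiff :: "(int \<Rightarrow> complex) \<Rightarrow> int \<Rightarrow> complex" where
  "fdiff u = (\<lambda>n. u (n + 1)) - u"

lemma l2_fdiff: "u \<in> l2 \<Longrightarrow> fdiff u \<in> l2"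
  by (simp add: fdiff_def l2_diff l2_shift)

text \<open>Summation by parts: the backward shift acting on \<open>fdiff v\<close> is moved to the
  other argument as a forward shift on \<open>u\<close>. Shifts of the whole of the integers are
  bijective, so no boundary terms arise.\<close>

lemma ip_neg_laplacian:
  assumes "u \<in> l2" "v \<in> l2"
  shows "ip u (neg_laplacian v) = ip (fdiff u) (fdiff v)"
proof -
  \<comment> \<open>The shift is written \<open>n + (- 1)\<close> to match the form
    \<open>n + k\<close> in \<open>l2_shift\<close>.\<close>
  have "neg_laplacian v = (\<lambda>n. fdiff v (n + (- 1))) - fdiff v"
    by (simp add: neg_laplacian_def fdiff_def fun_eq_iff)
  then have "ip u (neg_laplacian v) = ip u (\<lambda>n. fdiff v (n + (- 1))) - ip u (fdiff v)"
    by (simp only: ip_diff_right assms l2_fdiff l2_shift)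
  also have "ip u (\<lambda>n. fdiff v (n + (- 1))) = ip (\<lambda>n. u (n + 1)) (fdiff v)"
    using ip_shift[of u 1 "\<lambda>n. fdiff v (n + (- 1))"] by simp
  also have "\<dots> - ip u (fdiff v) = ip (fdiff u) (fdiff v)"
    by (simp only: fdiff_def[of u] ip_diff_left assms l2_fdiff l2_shift)
  finally show ?thesis .
qed

lemma l2_neg_laplacian: "u \<in> l2 \<Longrightarrow> neg_laplacian u \<in> l2"
proof -
  assume u: "u \<in> l2"
  have "neg_laplacian u = (\<lambda>n. fdiff u (n + (- 1))) - fdiff u"
    by (simp add: neg_laplacian_def fdiff_def fun_eq_iff)
  then show ?thesis
    by (simp only: l2_diff l2_shift l2_fdiff u)
qed

lemma schroedinger_eq:
  "schroedinger V u = neg_laplacian u + (\<lambda>n. complex_of_real (V n) * u n)"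
  by (simp add: schroedinger_def fun_eq_iff)

lemma schroedinger_add: "schroedinger V (u + v) = schroedinger V u + schroedinger V v"
  by (simp add: schroedinger_def neg_laplacian_def fun_eq_iff algebra_simps)

lemma schroedinger_zero: "schroedinger V 0 = 0"
  by (simp add: schroedinger_def neg_laplacian_def fun_eq_iff)

lemma schroedinger_scale: "schroedinger V (scale_seq c u) = scale_seq c (schroedinger V u)"
  by (simp add: schroedinger_def neg_laplacian_def scale_seq_def fun_eq_iff algebra_simps)

lemma schroedinger_sum:
  "finite F \<Longrightarrow> schroedinger V (sum f F) = (\<Sum>x\<in>F. schroedinger V (f x))"
  by (induction F rule: finite_induct)
    (simp_all only: sum.empty sum.insert schroedinger_zero schroedinger_add not_False_eq_True)

lemma green_identity:
  assumes "bounded (range V)" "u \<in> l2" "v \<in> l2"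
  shows "ip u (schroedinger V v) =
    ip (fdiff u) (fdiff v) + ip u (\<lambda>n. complex_of_real (V n) * v n)"
  by (simp add: schroedinger_eq ip_add_right ip_neg_laplacian assms l2_neg_laplacian
      l2_multiplier[OF assms(1)])

text \<open>Exchanging \<open>u\<close> and \<open>v\<close> conjugates both terms of
  \<open>green_identity\<close>, the potential term because \<open>V\<close> is real.\<close>

lemma schroedinger_symmetric:
  assumes "bounded (range V)" "u \<in> l2" "v \<in> l2"
  shows "ip (schroedinger V u) v = ip u (schroedinger V v)"
proof -
  have "cnj (ip v (\<lambda>n. complex_of_real (V n) * u n)) = ip u (\<lambda>n. complex_of_real (V n) * v n)"
    by (simp add: ip_def infsum_cnj[symmetric] mult_ac del: infsum_cnj)
  then show ?thesis
    using ip_commute[of v "schroedinger V u"] ip_commute[of "fdiff v" "fdiff u"]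
      green_identity[OF assms(1,2,3)] green_identity[OF assms(1,3,2)]
    by (metis complex_cnj_add ip_commute)
qed

lemma quadratic_form:
  assumes "bounded (range V)" "u \<in> l2"
  shows "ip u (schroedinger V u) = complex_of_real
    ((\<Sum>\<^sub>\<infinity>n. (cmod (fdiff u n))\<^sup>2) + (\<Sum>\<^sub>\<infinity>n. V n * (cmod (u n))\<^sup>2))"
proof -
  have "cnj (u n) * (complex_of_real (V n) * u n) = complex_of_real (V n * (cmod (u n))\<^sup>2)" for n
    by (metis complex_norm_square mult.commute mult.left_commute of_real_mult)
  then have "ip u (\<lambda>n. complex_of_real (V n) * u n) = complex_of_real (\<Sum>\<^sub>\<infinity>n. V n * (cmod (u n))\<^sup>2)"
    by (simp only: ip_def infsum_complex_of_real)
  then show ?thesis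
    by (simp add: green_identity[OF assms(1)] assms ip_self)
qed

section \<open>Eigenvalues and eigenvectors\<close>

lemma eigenvalue_real:
  assumes "bounded (range V)" "is_eigenvalue (schroedinger V) z"
  shows "z = complex_of_real (Re z)"
proof -
  obtain u where u: "u \<in> l2" "u \<noteq> 0" and e: "schroedinger V u = scale_seq z u"
    using assms(2) by (auto simp: is_eigenvalue_def eigenspace_def)
  let ?r = "\<Sum>\<^sub>\<infinity>n. (cmod (u n))\<^sup>2"
  obtain q where "ip u (schroedinger V u) = complex_of_real q"
    using quadratic_form[OF assms(1) u(1)] by blast
  then have "z * complex_of_real ?r = complex_of_real q"
    by (simp add: e ip_scale_right ip_self)
  moreover have "?r > 0"
    using ip_self_pos[OF u] by (simp add: ip_self)
  ultimately have "z = complex_of_real (q / ?r)"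
    by (simp add: field_simps)
  then show ?thesis
    by simp
qed

lemma eigenvectors_orthogonal:
  assumes "bounded (range V)" "x \<noteq> y"
    "u \<in> eigenspace (schroedinger V) (complex_of_real x)"
    "v \<in> eigenspace (schroedinger V) (complex_of_real y)"
  shows "ip u v = 0"
proof -
  have l2: "u \<in> l2" "v \<in> l2"
    and e: "schroedinger V u = scale_seq (of_real x) u" "schroedinger V v = scale_seq (of_real y) v"
    using assms(3,4) by (auto simp: eigenspace_def)
  have "ip (scale_seq (of_real x) u) v = of_real x * ip u v"
    using ip_scale_right[of v "of_real x" u] by (metis complex_cnj_complex_of_real complex_cnj_mult ip_commute)
  then have "of_real x * ip u v = of_real y * ip u v"
    using schroedinger_symmetric[OF assms(1) l2] by (simp add: e ip_scale_right)
  then show ?thesis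
    using assms(2) by simp
qed

lemma l2_fdiff_zero:
  assumes "u \<in> l2" "fdiff u = 0"
  shows "u = 0"
proof -
  have step: "u (n + 1) = u n" for n
    using fun_cong[OF assms(2), of n] by (simp add: fdiff_def)
  have const: "u n = u 0" for n
  proof (induction n rule: int_induct[where k = 0])
    case (step1 i)
    then show ?case
      using step[of i] by simp
  next
    case (step2 i)
    then show ?case
      using step[of "i - 1"] by simp
  qed simp
  have "u 0 = 0"
  proof (rule ccontr)
    assume "u 0 \<noteq> 0"
    \<comment> \<open>For a nonzero constant sequence this superlevel set would be all of the
      integers.\<close>
    then have "finite {n. (cmod (u 0))\<^sup>2 \<le> (cmod (u n))\<^sup>2}"
      using assms(1) by (intro summable_on_finite_superlevel) (auto simp: l2_iff)
    moreover have "{n. (cmod (u 0))\<^sup>2 \<le> (cmod (u n))\<^sup>2} = UNIV"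
      by (metis (mono_tags, lifting) UNIV_eq_I const mem_Collect_eq order_refl)
    ultimately show False
      using infinite_UNIV_int by simp
  qed
  then show ?thesis
    using const by (metis ext zero_fun_apply)
qed

text \<open>The lower bound \<open>\<omega>\<close> is left arbitrary because the lemma serves
  twice: for \<open>V\<close> with \<open>omega_min V\<close>, and for \<open>- V\<close> with
  \<open>4 - omega_max V\<close>.\<close>

lemma eigenvalue_gt:
  assumes bd: "bounded (range V)" and "is_eigenvalue (schroedinger V) z"
    and low: "\<And>n. \<omega> \<le> V n"
  shows "\<omega> < Re z"
proof -
  obtain u where u: "u \<in> l2" "u \<noteq> 0" and e: "schroedinger V u = scale_seq z u"
    using assms(2) by (auto simp: is_eigenvalue_def eigenspace_def)
  let ?r = "\<Sum>\<^sub>\<infinity>n. (cmod (u n))\<^sup>2" and ?d = "\<Sum>\<^sub>\<infinity>n. (cmod (fdiff u n))\<^sup>2"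
  have s: "(\<lambda>n. (cmod (u n))\<^sup>2) summable_on UNIV"
    using u by (simp add: l2_iff)
  have pos: "?r > 0"
    using ip_self_pos[OF u] by (simp add: ip_self)
  have "fdiff u \<noteq> 0"
    using l2_fdiff_zero u by blast
  then have d: "?d > 0"
    using ip_self_pos[OF l2_fdiff[OF u(1)]] by (simp add: ip_self)
  have "Re z * ?r = ?d + (\<Sum>\<^sub>\<infinity>n. V n * (cmod (u n))\<^sup>2)"
    using arg_cong[OF quadratic_form[OF bd u(1)], of Re] by (simp add: e ip_scale_right ip_self)
  moreover have "\<omega> * ?r \<le> (\<Sum>\<^sub>\<infinity>n. V n * (cmod (u n))\<^sup>2)"
    by (subst infsum_cmult_right'[symmetric], rule infsum_mono)
      (auto simp: s l2_potential_summable bd u low mult_right_mono intro: summable_on_cmult_right)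
  ultimately have "\<omega> * ?r < Re z * ?r"
    using d by linarith
  then show ?thesis
    using pos by simp
qed

subsection \<open>Finiteness of the negative spectrum\<close>

lemma eigenspace_l2: "u \<in> eigenspace A z \<Longrightarrow> u \<in> l2"
  by (simp add: eigenspace_def)

lemma subspace_eigenspace: "cseq.subspace (eigenspace (schroedinger V) z)"
proof -
  have "scale_seq c (scale_seq z u) = scale_seq z (scale_seq c u)" for c u
    by (simp add: mult.commute)
  then show ?thesis
    by (auto simp: cseq.subspace_def eigenspace_def schroedinger_zero schroedinger_add
        schroedinger_scale l2_zero l2_add l2_scale cseq.scale_right_distrib)
qed

text \<open>Collects the terms of a linear combination by eigenvalue. Asking that
  \<open>\<psi> x\<close> lie in its eigenspace for every real \<open>x\<close> costs nothing, since
  0 is available, and spares side conditions later.\<close>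

lemma span_eigenspaces_decompose:
  assumes "u \<in> cseq.span (\<Union>x\<in>X. eigenspace (schroedinger V) (complex_of_real x))"
  shows "\<exists>F \<psi>. finite F \<and> F \<subseteq> X \<and> (\<forall>x. \<psi> x \<in> eigenspace (schroedinger V) (complex_of_real x))
    \<and> u = sum \<psi> F"
  using assms
proof (induction rule: cseq.span_induct_alt)
  case base
  have "\<forall>x. 0 \<in> eigenspace (schroedinger V) (complex_of_real x)"
    by (simp add: cseq.subspace_0 subspace_eigenspace)
  then show ?case
    by (intro exI[of _ "{}"] exI[of _ "\<lambda>_. 0"] conjI) (simp_all only: sum.empty finite.emptyI empty_subsetI simp_thms)
next
  case (step c v y)
  then obtain x0 where x0: "x0 \<in> X" "v \<in> eigenspace (schroedinger V) (complex_of_real x0)"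
    by blast
  from step obtain F \<psi> where F: "finite F" "F \<subseteq> X" "y = sum \<psi> F"
    and \<psi>: "\<And>x. \<psi> x \<in> eigenspace (schroedinger V) (complex_of_real x)"
    by blast
  \<comment> \<open>The new vector joins the component at \<open>x0\<close>, whether or not
    \<open>x0\<close> is already in \<open>F\<close>. The cut-off of \<open>\<psi>\<close> matters
    when \<open>x0\<close> is new, because \<open>\<psi> x0\<close> may then be nonzero although it
    is no part of \<open>y\<close>.\<close>
  define \<phi> where
    "\<phi> = (\<lambda>x. (if x = x0 then scale_seq c v else 0) + (if x \<in> F then \<psi> x else 0))"
  have "(\<Sum>x\<in>insert x0 F. if x = x0 then scale_seq c v else 0) = scale_seq c v"
    using F(1) by (subst sum.delta) simp_all
  moreover have "(\<Sum>x\<in>insert x0 F. if x \<in> F then \<psi> x else 0) = sum \<psi> F"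
    using F(1) by (intro sum.mono_neutral_cong_right) auto
  ultimately have "sum \<phi> (insert x0 F) = scale_seq c v + y"
    by (simp only: \<phi>_def sum.distrib F(3))
  moreover have "\<phi> x \<in> eigenspace (schroedinger V) (complex_of_real x)" for x
    using x0(2) \<psi> unfolding \<phi>_def
    by (intro cseq.subspace_add[OF subspace_eigenspace])
      (auto simp: cseq.subspace_0 cseq.subspace_scale subspace_eigenspace)
  ultimately show ?case
    using x0(1) F(1,2)
    by (intro exI[of _ "insert x0 F"] exI[of _ \<phi>] conjI allI) auto
qed

text \<open>Components for distinct eigenvalues are orthogonal, so the energy is the sum of
  \<open>x * Re (ip (\<psi> x) (\<psi> x))\<close> over \<open>F\<close>. Each term is at most 0,
  and one with \<open>\<psi> x \<noteq> 0\<close> is negative.\<close>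

lemma span_negative_eigenspaces_energy:
  assumes bd: "bounded (range V)" and neg: "X \<subseteq> {..<0}"
    and u: "u \<in> cseq.span (\<Union>x\<in>X. eigenspace (schroedinger V) (complex_of_real x))" "u \<noteq> 0"
  shows "Re (ip u (schroedinger V u)) < 0"
proof -
  obtain F \<psi> where F: "finite F" "F \<subseteq> X" "u = sum \<psi> F"
    and \<psi>: "\<And>x. \<psi> x \<in> eigenspace (schroedinger V) (complex_of_real x)"
    using span_eigenspaces_decompose[OF u(1)] by blast
  have l2: "\<psi> x \<in> l2" for x
    using \<psi> eigenspace_l2 by blast
  have ul2: "u \<in> l2"
    unfolding F(3) by (intro l2_sum l2)
  have ip: "ip u (\<psi> x) = complex_of_real (Re (ip (\<psi> x) (\<psi> x)))" if "x \<in> F" for x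
  proof -
    \<comment> \<open>The sum is expanded in the second argument, where \<open>ip\<close> is linear,
      and conjugated back afterwards.\<close>
    have "ip (\<psi> x) u = (\<Sum>y\<in>F. ip (\<psi> x) (\<psi> y))"
      by (simp only: F(3) ip_sum_right[OF F(1) l2 l2])
    also have "\<dots> = (\<Sum>y\<in>F. if y = x then ip (\<psi> x) (\<psi> x) else 0)"
      using eigenvectors_orthogonal[OF bd _ \<psi> \<psi>] by (intro sum.cong) auto
    also have "\<dots> = ip (\<psi> x) (\<psi> x)"
      using that F(1) by simp
    finally have "ip u (\<psi> x) = cnj (ip (\<psi> x) (\<psi> x))"
      using ip_commute[of u "\<psi> x"] by simp
    then show ?thesis
      by (simp add: ip_self)
  qed
  have "schroedinger V u = (\<Sum>x\<in>F. scale_seq (complex_of_real x) (\<psi> x))"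
    using \<psi> unfolding F(3) schroedinger_sum[OF F(1)]
    by (intro sum.cong) (auto simp: eigenspace_def)
  then have "ip u (schroedinger V u) = (\<Sum>x\<in>F. complex_of_real x * ip u (\<psi> x))"
    by (simp only: ip_sum_right[OF F(1) ul2 l2_scale[OF l2]] ip_scale_right)
  also have "\<dots> = (\<Sum>x\<in>F. complex_of_real (x * Re (ip (\<psi> x) (\<psi> x))))"
    by (intro sum.cong) (simp_all add: ip)
  finally have eq: "Re (ip u (schroedinger V u)) = - (\<Sum>x\<in>F. (- x) * Re (ip (\<psi> x) (\<psi> x)))"
    by (simp add: sum_negf)
  have "\<exists>x\<in>F. \<psi> x \<noteq> 0"
    using u(2) unfolding F(3) by (metis sum.neutral)
  then obtain x where x: "x \<in> F" "\<psi> x \<noteq> 0"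
    by blast
  have "0 < (\<Sum>x\<in>F. (- x) * Re (ip (\<psi> x) (\<psi> x)))"
  proof (rule sum_pos2[OF F(1) x(1)])
    show "0 < - x * Re (ip (\<psi> x) (\<psi> x))"
      using ip_self_pos[OF l2 x(2)] x(1) F(2) neg by (intro mult_pos_pos) auto
    show "0 \<le> - y * Re (ip (\<psi> y) (\<psi> y))" if "y \<in> F" for y
      using that F(2) neg by (intro mult_nonneg_nonneg ip_self_nonneg) auto
  qed
  then show ?thesis
    by (simp only: eq)
qed

section \<open>Pointwise bounds by the sum of squared differences\<close>

lemma fdiff_telescope:
  assumes "m \<le> n"
  shows "u n - u m = (\<Sum>i\<in>{m..<n}. fdiff u i)"
  using assms
proof (induction n rule: int_ge_induct)
  case (step n)
  have "{m..<n + 1} = insert n {m..<n}"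
    using step(1) by auto
  then have "(\<Sum>i\<in>{m..<n + 1}. fdiff u i) = fdiff u n + (u n - u m)"
    using step by simp
  then show ?case
    by (simp add: fdiff_def)
qed simp

lemma cmod_diff_le:
  assumes "u \<in> l2" "m \<le> n"
  shows "(cmod (u n - u m))\<^sup>2 \<le> real_of_int (n - m) * (\<Sum>\<^sub>\<infinity>i. (cmod (fdiff u i))\<^sup>2)"
proof -
  \<comment> \<open>The factor 1 prepares Cauchy-Schwarz; its squares add up to
    \<open>n - m\<close>.\<close>
  have "(cmod (u n - u m))\<^sup>2 \<le> (\<Sum>i\<in>{m..<n}. 1 * cmod (fdiff u i))\<^sup>2"
    unfolding fdiff_telescope[OF assms(2)] by (intro power_mono) (auto intro: norm_sum)
  also have "\<dots> \<le> (\<Sum>i\<in>{m..<n}. 1\<^sup>2) * (\<Sum>i\<in>{m..<n}. (cmod (fdiff u i))\<^sup>2)"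
    by (rule Cauchy_Schwarz_ineq_sum)
  also have "\<dots> = real_of_int (n - m) * (\<Sum>i\<in>{m..<n}. (cmod (fdiff u i))\<^sup>2)"
    using assms(2) by simp
  also have "\<dots> \<le> real_of_int (n - m) * (\<Sum>\<^sub>\<infinity>i. (cmod (fdiff u i))\<^sup>2)"
    using assms l2_fdiff[OF assms(1)]
    by (intro mult_left_mono finite_sum_le_infsum) (auto simp: l2_iff)
  finally show ?thesis .
qed

text \<open>The telescoping path joins 0 to \<open>n\<close>, so it has \<open>\<bar>n\<bar>\<close>
  steps; the two signs of \<open>n\<close> use it in opposite directions.\<close>

lemma cmod_le_fdiff:
  assumes "u \<in> l2" "u 0 = 0"
  shows "(cmod (u n))\<^sup>2 \<le> \<bar>real_of_int n\<bar> * (\<Sum>\<^sub>\<infinity>i. (cmod (fdiff u i))\<^sup>2)"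
  using cmod_diff_le[OF assms(1), of 0 n] cmod_diff_le[OF assms(1), of n 0] assms(2)
  by (cases "0 \<le> n") simp_all

lemma energy_nonneg:
  assumes bd: "bounded (range V)" and u: "u \<in> l2" "u 0 = 0" "\<And>n. n \<in> F \<Longrightarrow> u n = 0"
    and s: "(\<lambda>n. \<bar>real_of_int n\<bar> * \<bar>V n\<bar>) summable_on UNIV"
    and F: "(\<Sum>\<^sub>\<infinity>n\<in>- F. \<bar>real_of_int n\<bar> * \<bar>V n\<bar>) \<le> 1"
  shows "0 \<le> Re (ip u (schroedinger V u))"
proof -
  define G where "G = (\<Sum>\<^sub>\<infinity>n. (cmod (fdiff u n))\<^sup>2)"
  have G: "0 \<le> G"
    by (simp add: G_def infsum_nonneg)
  \<comment> \<open>The index sets differ by \<open>F\<close>, where the right-hand terms vanish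
    with \<open>u\<close>. Since the weighted tail is at most 1, the potential term is at least
    \<open>- G\<close> and the difference term \<open>G\<close> compensates it.\<close>
  have "(\<Sum>\<^sub>\<infinity>n\<in>- F. (- G) * (\<bar>real_of_int n\<bar> * \<bar>V n\<bar>)) \<le> (\<Sum>\<^sub>\<infinity>n. V n * (cmod (u n))\<^sup>2)"
  proof (rule infsum_mono_neutral)
    show "(\<lambda>n. - G * (\<bar>real_of_int n\<bar> * \<bar>V n\<bar>)) summable_on - F"
      by (intro summable_on_cmult_right summable_on_subset_banach[OF s]) simp
    show "(\<lambda>n. V n * (cmod (u n))\<^sup>2) summable_on UNIV"
      by (rule l2_potential_summable[OF bd u(1)])
    fix n
    show "- G * (\<bar>real_of_int n\<bar> * \<bar>V n\<bar>) \<le> V n * (cmod (u n))\<^sup>2"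
    proof -
      have "\<bar>V n\<bar> * (cmod (u n))\<^sup>2 \<le> \<bar>V n\<bar> * (\<bar>real_of_int n\<bar> * G)"
        using cmod_le_fdiff[OF u(1,2), of n] by (intro mult_left_mono) (auto simp: G_def)
      moreover have "- (\<bar>V n\<bar> * (cmod (u n))\<^sup>2) \<le> V n * (cmod (u n))\<^sup>2"
        using mult_right_mono[of "- \<bar>V n\<bar>" "V n" "(cmod (u n))\<^sup>2"] by simp
      ultimately show ?thesis
        by (simp add: mult_ac)
    qed
  qed (use u(3) in auto)
  moreover have "G * (\<Sum>\<^sub>\<infinity>n\<in>- F. \<bar>real_of_int n\<bar> * \<bar>V n\<bar>) \<le> G"
    using F G by (simp add: mult_left_le)
  ultimately show ?thesis
    unfolding quadratic_form[OF bd u(1)] G_def[symmetric] infsum_cmult_right'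
    by simp
qed

text \<open>A basis of \<open>E\<close> is carried by \<open>R\<close> to an independent family
  inside the span of the finite set \<open>D\<close>, hence to a finite one; injectivity makes the
  basis itself finite.\<close>

lemma finite_dimensional_inj_on:
  assumes lin: "Vector_Spaces.linear scale_seq scale_seq R"
    and E: "cseq.subspace E" and inj: "inj_on R E"
    and fd: "finite D" "R ` E \<subseteq> cseq.span D"
  shows "finite_dimensional E"
proof -
  interpret R: Vector_Spaces.linear scale_seq scale_seq R
    by (rule lin)
  obtain B where B: "B \<subseteq> E" "cseq.independent B" "E \<subseteq> cseq.span B"
    using cseq.maximal_independent_subset by blast
  have spB: "cseq.span B \<subseteq> E"
    using B(1) E by (rule cseq.span_minimal)
  have "cseq.independent (R ` B)"
    using B(2) inj_on_subset[OF inj spB] by (rule R.independent_injective_image)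
  then have "finite (R ` B)"
    using cseq.independent_span_bound[OF fd(1)] B(1) fd(2) by blast
  then have "finite B"
    using finite_imageD inj_on_subset[OF inj B(1)] by blast
  then show ?thesis
    using B(3) unfolding finite_dimensional_def by blast
qed

lemma finite_dimensional_negative:
  assumes bd: "bounded (range V)" and s: "(\<lambda>n. \<bar>real_of_int n\<bar> * \<bar>V n\<bar>) summable_on UNIV"
    and neg: "X \<subseteq> {..<0}"
  shows "finite_dimensional
    (cseq.span (\<Union>x\<in>X. eigenspace (schroedinger V) (complex_of_real x)))"
proof -
  define E where "E = cseq.span (\<Union>x\<in>X. eigenspace (schroedinger V) (complex_of_real x))"
  obtain F where F: "finite F" "(\<Sum>\<^sub>\<infinity>n\<in>- F. \<bar>real_of_int n\<bar> * \<bar>V n\<bar>) \<le> 1"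
    using summable_on_small_tail[OF s zero_less_one] by blast
  \<comment> \<open>Restriction to finitely many sites. The site 0 is added because the pointwise
    bound starts from \<open>u 0 = 0\<close>.\<close>
  define R :: "(int \<Rightarrow> complex) \<Rightarrow> int \<Rightarrow> complex"
    where "R = (\<lambda>u n. if n \<in> insert 0 F then u n else 0)"
  define \<delta> :: "int \<Rightarrow> int \<Rightarrow> complex" where "\<delta> = (\<lambda>m n. if n = m then 1 else 0)"
  have lin: "Vector_Spaces.linear scale_seq scale_seq R"
    by unfold_locales (auto simp: R_def scale_seq_def fun_eq_iff)
  have subsp: "cseq.subspace E"
    by (simp add: E_def cseq.subspace_span)
  have El2: "E \<subseteq> l2"
    unfolding E_def by (rule cseq.span_minimal[OF _ subspace_l2]) (auto simp: eigenspace_l2)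
  have inj: "inj_on R E"
  proof (rule inj_onI)
    fix u v assume uv: "u \<in> E" "v \<in> E" and Ruv: "R u = R v"
    have w: "u - v \<in> E"
      using uv subsp by (simp add: cseq.subspace_diff)
    have "(u - v) n = 0" if "n \<in> insert 0 F" for n
      using fun_cong[OF Ruv, of n] that by (auto simp: R_def split: if_splits)
    \<comment> \<open>A nonzero difference in \<open>E\<close> would have negative energy.\<close>
    then have "0 \<le> Re (ip (u - v) (schroedinger V (u - v)))"
      using w El2 by (intro energy_nonneg[OF bd _ _ _ s F(2)]) auto
    then have "u - v = 0"
      using span_negative_eigenspaces_energy[OF bd neg, of "u - v"] w unfolding E_def
      by fastforce
    then show "u = v"
      by simp
  qed
  have "R u \<in> cseq.span (\<delta> ` insert 0 F)" for u
  proof -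
    \<comment> \<open>Evaluation at a site commutes with a finite sum of sequences.\<close>
    have ap: "(\<Sum>m\<in>A. scale_seq (u m) (\<delta> m)) n = (\<Sum>m\<in>A. u m * \<delta> m n)" if "finite A" for A n
      using that by (induction A) (simp_all add: scale_seq_def)
    have "R u = (\<Sum>m\<in>insert 0 F. scale_seq (u m) (\<delta> m))"
    proof
      fix n
      have "(\<Sum>m\<in>insert 0 F. u m * \<delta> m n) = (\<Sum>m\<in>insert 0 F. if n = m then u m else 0)"
        by (intro sum.cong) (simp_all add: \<delta>_def)
      also have "\<dots> = R u n"
        using F(1) by (subst sum.delta') (simp_all add: R_def)
      finally show "R u n = (\<Sum>m\<in>insert 0 F. scale_seq (u m) (\<delta> m)) n"
        using F(1) ap[of "insert 0 F" n] by simp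
    qed
    then show ?thesis
      by (simp only:) (intro cseq.span_sum cseq.span_scale cseq.span_base imageI)
  qed
  then show ?thesis
    using F(1) unfolding E_def[symmetric]
    by (intro finite_dimensional_inj_on[OF lin subsp inj, of "\<delta> ` insert 0 F"]) auto
qed

text \<open>One eigenvector is chosen for each point of \<open>X\<close>. They are nonzero and
  mutually orthogonal, hence independent, and they lie in a finite-dimensional space.\<close>

lemma finite_eigenvalues:
  assumes bd: "bounded (range V)"
    and X: "\<And>x. x \<in> X \<Longrightarrow> is_eigenvalue (schroedinger V) (complex_of_real x)"
    and fd: "finite_dimensional
      (cseq.span (\<Union>x\<in>X. eigenspace (schroedinger V) (complex_of_real x)))"
  shows "finite X"
proof -
  have "\<exists>f. \<forall>x\<in>X. f x \<in> eigenspace (schroedinger V) (complex_of_real x) \<and> f x \<noteq> 0"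
    using X unfolding is_eigenvalue_def by (intro bchoice) blast
  then obtain f where f: "\<And>x. x \<in> X \<Longrightarrow> f x \<in> eigenspace (schroedinger V) (complex_of_real x)"
    and f0: "\<And>x. x \<in> X \<Longrightarrow> f x \<noteq> 0"
    by blast
  have l2: "f x \<in> l2" if "x \<in> X" for x
    using f[OF that] eigenspace_l2 by blast
  have self: "ip (f x) (f x) \<noteq> 0" if "x \<in> X" for x
    using ip_self_pos[OF l2 f0] that by fastforce
  have orth: "ip (f x) (f y) = 0" if "x \<in> X" "y \<in> X" "x \<noteq> y" for x y
    using eigenvectors_orthogonal[OF bd that(3)] f that by blast
  have inj: "inj_on f X"
    using self orth by (metis inj_onI)
  have "f x \<notin> cseq.span (f ` X - {f x})" if x: "x \<in> X" for x
  proof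
    assume "f x \<in> cseq.span (f ` X - {f x})"
    \<comment> \<open>Membership in \<open>l2\<close> is carried through the induction because
      additivity of \<open>ip\<close> depends on it.\<close>
    moreover have "v \<in> l2 \<and> ip (f x) v = 0" if "v \<in> cseq.span (f ` X - {f x})" for v
      using that
    proof (induction rule: cseq.span_induct_alt)
      case base
      show ?case
        by (intro conjI l2_zero ip_zero_right)
    next
      case (step c v y)
      then obtain x' where "x' \<in> X" "v = f x'" "x \<noteq> x'"
        by blast
      then have "v \<in> l2" "ip (f x) v = 0"
        using l2 orth x by simp_all
      with step(2) show ?case
        using l2[OF x] by (simp only: l2_add l2_scale ip_add_right ip_scale_right) simp
    qed
    ultimately have "ip (f x) (f x) = 0"
      by blast
    then show False
      using self[OF x] by simp
  qed
  then have "cseq.independent (f ` X)"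
    unfolding cseq.dependent_def by blast
  moreover obtain D where "finite D"
    "cseq.span (\<Union>x\<in>X. eigenspace (schroedinger V) (complex_of_real x)) \<subseteq> cseq.span D"
    using fd unfolding finite_dimensional_def by blast
  moreover have "f ` X \<subseteq> cseq.span (\<Union>x\<in>X. eigenspace (schroedinger V) (complex_of_real x))"
    using f by (auto intro: cseq.span_base)
  ultimately have "finite (f ` X)"
    using cseq.independent_span_bound by blast
  then show ?thesis
    using inj finite_imageD by blast
qed

subsection \<open>The reflection of the spectrum at 2\<close>

text \<open>Multiplication by (-1)^n, phrased by parity since \<open>n\<close> may be
  negative.\<close>

definition flip :: "(int \<Rightarrow> complex) \<Rightarrow> int \<Rightarrow> complex" where
  "flip u = (\<lambda>n. if even n then u n else - u n)"

lemma flip_flip [simp]: "flip (flip u) = u"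
  by (simp add: flip_def fun_eq_iff)

lemma linear_flip: "Vector_Spaces.linear scale_seq scale_seq flip"
  by unfold_locales (auto simp: flip_def scale_seq_def fun_eq_iff)

lemma l2_flip: "u \<in> l2 \<Longrightarrow> flip u \<in> l2"
  by (erule l2_dominated[where c = 1]) (simp add: flip_def)

text \<open>Neighbouring sites have opposite parity, so the two neighbour terms change sign while
  the diagonal \<open>2 + V n\<close> stays; and \<open>2 + V n = 4 - (2 - V n)\<close>.\<close>

lemma schroedinger_flip:
  "schroedinger V (flip u) = flip (scale_seq 4 u - schroedinger (\<lambda>n. - V n) u)"
  by (simp add: schroedinger_def neg_laplacian_def flip_def scale_seq_def fun_eq_iff algebra_simps)

lemma flip_eigenspace:
  assumes "u \<in> eigenspace (schroedinger V) z"
  shows "flip u \<in> eigenspace (schroedinger (\<lambda>n. - V n)) (4 - z)"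
proof -
  have u: "u \<in> l2" "schroedinger V u = scale_seq z u"
    using assms by (auto simp: eigenspace_def)
  have "schroedinger (\<lambda>n. - V n) (flip u) = flip (scale_seq 4 u - scale_seq z u)"
    using schroedinger_flip[of "\<lambda>n. - V n" u] u(2) by simp
  also have "\<dots> = scale_seq (4 - z) (flip u)"
    by (simp add: flip_def scale_seq_def fun_eq_iff algebra_simps)
  finally show ?thesis
    using l2_flip[OF u(1)] by (simp add: eigenspace_def)
qed

lemma is_eigenvalue_flip:
  assumes "is_eigenvalue (schroedinger V) z"
  shows "is_eigenvalue (schroedinger (\<lambda>n. - V n)) (4 - z)"
proof -
  obtain u where u: "u \<in> eigenspace (schroedinger V) z" "u \<noteq> 0"
    using assms by (auto simp: is_eigenvalue_def)
  have "flip 0 = 0"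
    by (simp add: flip_def fun_eq_iff)
  then have "flip u \<noteq> 0"
    using u(2) flip_flip[of u] by metis
  then show ?thesis
    using flip_eigenspace[OF u(1)] unfolding is_eigenvalue_def by blast
qed

lemma finite_dimensional_flip:
  assumes "finite_dimensional E"
  shows "finite_dimensional (flip ` E)"
proof -
  interpret flip: Vector_Spaces.linear scale_seq scale_seq flip
    by (rule linear_flip)
  obtain B where B: "finite B" "E \<subseteq> cseq.span B"
    using assms by (auto simp: finite_dimensional_def)
  have "flip ` E \<subseteq> cseq.span (flip ` B)"
    using image_mono[OF B(2), of flip] by (simp only: flip.span_image)
  with B(1) show ?thesis
    unfolding finite_dimensional_def by blast
qed

lemma finite_dimensional_span_Un:
  assumes "finite_dimensional E" "finite_dimensional F" "S \<subseteq> E \<union> F"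
  shows "finite_dimensional (cseq.span S)"
proof -
  obtain B C where BC: "finite B" "E \<subseteq> cseq.span B" "finite C" "F \<subseteq> cseq.span C"
    using assms(1,2) by (auto simp: finite_dimensional_def)
  have "S \<subseteq> cseq.span (B \<union> C)"
    using assms(3) BC(2,4) cseq.span_mono[of B "B \<union> C"] cseq.span_mono[of C "B \<union> C"] by blast
  then have "cseq.span S \<subseteq> cseq.span (B \<union> C)"
    by (intro cseq.span_minimal cseq.subspace_span)
  with BC(1,3) show ?thesis
    unfolding finite_dimensional_def by (intro exI[of _ "B \<union> C"]) simp
qed

subsection \<open>The interval from 0 to 4\<close>

lemma finite_support_infsum:
  fixes f :: "int \<Rightarrow> real"
  assumes "finite A" "\<And>n. n \<notin> A \<Longrightarrow> f n = 0"
  shows "f summable_on UNIV" "(\<Sum>\<^sub>\<infinity>n. f n) = sum f A"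
proof -
  have "f summable_on A"
    using assms(1) by simp
  then show "f summable_on UNIV"
    by (rule summable_on_cong_neutral[THEN iffD1, rotated -1]) (use assms(2) in auto)
  have "infsum f UNIV = infsum f A"
    by (rule infsum_cong_neutral) (use assms(2) in auto)
  then show "(\<Sum>\<^sub>\<infinity>n. f n) = sum f A"
    using assms(1) by simp
qed

text \<open>A plane wave cut to \<open>N + 1\<close> sites violates the resolvent bound: its squared
  norm is \<open>N + 1\<close>, while the residual \<open>w\<close> is at most
  \<open>\<epsilon>\<close> in the bulk and at most 9 at no more than four further sites, however
  large \<open>N\<close> is.\<close>

lemma continuous_spectrum_subset:
  assumes decay: "\<And>\<epsilon>. 0 < \<epsilon> \<Longrightarrow> finite {n. \<epsilon> \<le> \<bar>V n\<bar>}" and x: "0 \<le> x" "x \<le> 4"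
  shows "complex_of_real x \<in> spectrum (schroedinger V)"
proof (rule ccontr)
  assume "\<not> ?thesis"
  then obtain C where C: "\<And>u. u \<in> l2 \<Longrightarrow>
      l2_norm u \<le> C * l2_norm (schroedinger V u - scale_seq (complex_of_real x) u)"
    unfolding spectrum_def resolvent_set_def by auto
  \<comment> \<open>Makes \<open>\<bar>C * \<epsilon>\<bar> \<le> 1 / 2\<close>, so the bulk error
    accounts for at most a quarter of the squared norm.\<close>
  define \<epsilon> where "\<epsilon> = 1 / (1 + \<bar>C\<bar>) / 2"
  have \<epsilon>: "0 < \<epsilon>" "\<epsilon> \<le> 1" "C\<^sup>2 * \<epsilon>\<^sup>2 \<le> 1 / 4"
  proof -
    show "0 < \<epsilon>" "\<epsilon> \<le> 1"
      using abs_ge_zero[of C] by (auto simp: \<epsilon>_def field_simps)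
    have "\<bar>C * \<epsilon>\<bar> \<le> 1 / 2"
      using abs_ge_zero[of C] by (simp add: \<epsilon>_def abs_mult field_simps)
    then have "\<bar>C * \<epsilon>\<bar>\<^sup>2 \<le> (1 / 2)\<^sup>2"
      by (intro power_mono) auto
    then show "C\<^sup>2 * \<epsilon>\<^sup>2 \<le> 1 / 4"
      by (simp add: power_mult_distrib power_divide)
  qed
  obtain M where M: "\<And>n. M \<le> n \<Longrightarrow> \<bar>V n\<bar> < \<epsilon>"
  proof -
    obtain m where m: "\<And>n. n \<in> {n. \<epsilon> \<le> \<bar>V n\<bar>} \<Longrightarrow> n \<le> m"
      using bdd_above_finite[OF decay[OF \<epsilon>(1)]] unfolding bdd_above_def by blast
    have "\<bar>V n\<bar> < \<epsilon>" if "m + 1 \<le> n" for n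
      using m[of n] that by force
    then show ?thesis
      using that by blast
  qed
  \<comment> \<open>The left side is the total boundary error after multiplication by
    \<open>C\<^sup>2\<close>.\<close>
  obtain N :: nat where N: "4 * C\<^sup>2 * 81 < real N / 2"
    using reals_Archimedean2[of "2 * (4 * C\<^sup>2 * 81)"] by auto
  \<comment> \<open>The frequency solving \<open>2 - 2 * cos \<theta> = x\<close>; the range of
    \<open>x\<close> puts the argument of \<open>arccos\<close> in [-1, 1].\<close>
  define \<theta> where "\<theta> = arccos ((2 - x) / 2)"
  have cos: "2 * cos \<theta> = 2 - x"
    using x by (simp add: \<theta>_def)
  define e where "e = (\<lambda>n::int. cis (\<theta> * real_of_int n))"
  have e: "e (n + 1) + e (n - 1) = complex_of_real (2 - x) * e n" for n
    unfolding cos[symmetric] e_def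
    by (simp add: complex_eq_iff distrib_left right_diff_distrib cos_add cos_diff sin_add sin_diff)
  have norm_e: "cmod (e n) = 1" for n
    by (simp add: e_def)
  define u where "u = (\<lambda>n. if n \<in> {M..M + int N} then e n else 0)"
  define w where "w = schroedinger V u - scale_seq (complex_of_real x) u"
  \<comment> \<open>The two end sites and their outer neighbours, where the cut-off spoils the
    recurrence for \<open>e\<close>.\<close>
  define B where "B = {M - 1, M, M + int N, M + int N + 1}"
  have w: "w n = - (u (n + 1) + u (n - 1) - 2 * u n) + complex_of_real (V n) * u n
      - complex_of_real x * u n" for n
    by (simp add: w_def schroedinger_def neg_laplacian_def scale_seq_def)
  have norm_u: "cmod (u n) \<le> 1" for n
    by (simp add: u_def norm_e)
  have w_out: "w n = 0" if "n \<notin> {M..M + int N} \<union> B" for n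
  proof -
    have "u (n + 1) = 0" "u (n - 1) = 0" "u n = 0"
      using that by (auto simp: u_def B_def)
    then show ?thesis
      by (simp add: w)
  qed
  have w_in: "(cmod (w n))\<^sup>2 \<le> \<epsilon>\<^sup>2" if "n \<in> {M..M + int N} - B" for n
  proof -
    have "u (n + 1) = e (n + 1)" "u (n - 1) = e (n - 1)" "u n = e n"
      using that by (auto simp: u_def B_def)
    then have "w n = complex_of_real (V n) * e n"
      using e[of n] by (simp add: w algebra_simps)
    then have "cmod (w n) \<le> \<epsilon>"
      using M[of n] that by (simp add: norm_mult norm_e)
    then show ?thesis
      by (intro power_mono) auto
  qed
  have w_B: "(cmod (w n))\<^sup>2 \<le> 81" for n
  proof -
    \<comment> \<open>Left of \<open>M\<close> the choice of \<open>M\<close> says nothing about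
      \<open>V n\<close>, but there \<open>u n = 0\<close>.\<close>
    have "cmod (complex_of_real (V n) * u n) \<le> 1"
      using M[of n] \<epsilon>(2) norm_e by (cases "M \<le> n") (auto simp: norm_mult u_def)
    moreover have "cmod (complex_of_real x * u n) \<le> 4"
      using x mult_mono[of x 4 "cmod (u n)" 1] norm_u[of n] by (simp add: norm_mult)
    moreover have "cmod (2 * u n) \<le> 2"
      using norm_u[of n] by (simp add: norm_mult)
    moreover have "cmod (w n) \<le> cmod (u (n + 1)) + cmod (u (n - 1)) + cmod (2 * u n)
        + cmod (complex_of_real (V n) * u n) + cmod (complex_of_real x * u n)"
    proof -
      have "cmod (- (a + b - c) + d - f) \<le> cmod a + cmod b + cmod c + cmod d + cmod f"
        for a b c d f
        by norm
      then show ?thesis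
        unfolding w .
    qed
    \<comment> \<open>The five contributions are 1 + 1 + 2 + 1 + 4.\<close>
    ultimately have "cmod (w n) \<le> 9"
      using norm_u[of "n + 1"] norm_u[of "n - 1"] by linarith
    then show ?thesis
      using power_mono[of "cmod (w n)" 9 2] by simp
  qed
  have ul2: "u \<in> l2"
    unfolding l2_iff by (rule finite_support_infsum[of "{M..M + int N}"]) (auto simp: u_def)
  have "(\<Sum>\<^sub>\<infinity>n. (cmod (u n))\<^sup>2) = (\<Sum>n\<in>{M..M + int N}. (cmod (u n))\<^sup>2)"
    by (rule finite_support_infsum) (auto simp: u_def)
  also have "\<dots> = (\<Sum>n\<in>{M..M + int N}. 1)"
    by (intro sum.cong) (auto simp: u_def norm_e)
  finally have nu: "(\<Sum>\<^sub>\<infinity>n. (cmod (u n))\<^sup>2) = real N + 1"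
    by simp
  have "(\<Sum>\<^sub>\<infinity>n. (cmod (w n))\<^sup>2) = (\<Sum>n\<in>({M..M + int N} - B) \<union> B. (cmod (w n))\<^sup>2)"
    by (rule finite_support_infsum) (use w_out in \<open>auto simp: B_def\<close>)
  also have "\<dots> = (\<Sum>n\<in>{M..M + int N} - B. (cmod (w n))\<^sup>2) + (\<Sum>n\<in>B. (cmod (w n))\<^sup>2)"
    by (rule sum.union_disjoint) (auto simp: B_def)
  also have "\<dots> \<le> (real N + 1) * \<epsilon>\<^sup>2 + 4 * 81"
  proof (rule add_mono)
    have "(\<Sum>n\<in>{M..M + int N} - B. (cmod (w n))\<^sup>2) \<le> real (card ({M..M + int N} - B)) * \<epsilon>\<^sup>2"
      using w_in by (rule sum_bounded_above)
    also have "\<dots> \<le> (real N + 1) * \<epsilon>\<^sup>2"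
      using card_mono[of "{M..M + int N}" "{M..M + int N} - B"] by (intro mult_right_mono) auto
    finally show "(\<Sum>n\<in>{M..M + int N} - B. (cmod (w n))\<^sup>2) \<le> (real N + 1) * \<epsilon>\<^sup>2" .
    have "(\<Sum>n\<in>B. (cmod (w n))\<^sup>2) \<le> real (card B) * 81"
      using w_B by (rule sum_bounded_above)
    also have "card B \<le> 4"
      using card_length[of "[M - 1, M, M + int N, M + int N + 1]"] by (simp add: B_def)
    finally show "(\<Sum>n\<in>B. (cmod (w n))\<^sup>2) \<le> 4 * 81"
      by simp
  qed
  finally have nw: "(\<Sum>\<^sub>\<infinity>n. (cmod (w n))\<^sup>2) \<le> (real N + 1) * \<epsilon>\<^sup>2 + 4 * 81" .
  have "l2_norm u \<le> \<bar>C\<bar> * l2_norm w"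
  proof -
    have "C * l2_norm w \<le> \<bar>C\<bar> * l2_norm w"
      by (intro mult_right_mono) (auto simp: l2_norm_eq infsum_nonneg)
    then show ?thesis
      using C[OF ul2] unfolding w_def by linarith
  qed
  then have "(l2_norm u)\<^sup>2 \<le> (\<bar>C\<bar> * l2_norm w)\<^sup>2"
    by (rule power_mono) (simp add: l2_norm_eq infsum_nonneg)
  then have "real N + 1 \<le> C\<^sup>2 * (\<Sum>\<^sub>\<infinity>n. (cmod (w n))\<^sup>2)"
    by (simp add: l2_norm_eq power_mult_distrib infsum_nonneg nu)
  also have "\<dots> \<le> C\<^sup>2 * ((real N + 1) * \<epsilon>\<^sup>2 + 4 * 81)"
    by (intro mult_left_mono nw) simp
  also have "\<dots> = (C\<^sup>2 * \<epsilon>\<^sup>2) * (real N + 1) + 4 * C\<^sup>2 * 81"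
    by (simp add: algebra_simps)
  also have "\<dots> \<le> 1 / 4 * (real N + 1) + real N / 2"
    using \<epsilon>(3) N by (intro add_mono mult_right_mono) auto
  finally show False
    by (simp add: field_simps)
qed

lemma not_isolated_in_interval:
  assumes sub: "\<And>x. 0 \<le> x \<Longrightarrow> x \<le> 4 \<Longrightarrow> complex_of_real x \<in> S"
    and x: "0 \<le> x" "x \<le> 4"
  shows "\<not> complex_of_real x isolated_in S"
proof
  assume "complex_of_real x isolated_in S"
  then obtain e where e: "e > 0"
    "\<And>y. y \<in> S \<Longrightarrow> dist (complex_of_real x) y < e \<Longrightarrow> y = complex_of_real x"
    unfolding isolated_in_dist_Ex_iff by blast
  define d where "d = min (e / 2) 1"
  \<comment> \<open>Moving away from the nearer endpoint by at most 1 keeps \<open>y\<close> in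
    [0, 4].\<close>
  define y where "y = (if x \<le> 2 then x + d else x - d)"
  have d: "0 < d" "d < e" "d \<le> 1"
    using e(1) by (auto simp: d_def)
  have "complex_of_real y \<in> S"
    using d x by (intro sub) (auto simp: y_def)
  moreover have "dist (complex_of_real x) (complex_of_real y) < e"
    using d by (simp add: dist_complex_def y_def flip: of_real_diff)
  ultimately have "y = x"
    using e(2) by fastforce
  then show False
    using d by (auto simp: y_def split: if_splits)
qed

subsection \<open>The potential\<close>

text \<open>Makes \<open>LEAST\<close> and \<open>GREATEST\<close> in \<open>omega_min\<close> and
  \<open>omega_max\<close> meaningful. If some value is negative, only finitely many values lie at
  or below it, and the smallest of them is the minimum; otherwise it is 0.\<close>

lemma decaying_attains_min:
  fixes f :: "int \<Rightarrow> real"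
  assumes "\<And>\<epsilon>. 0 < \<epsilon> \<Longrightarrow> finite {n. \<epsilon> \<le> \<bar>f n\<bar>}"
  shows "\<exists>m\<in>{0} \<union> range f. \<forall>x\<in>{0} \<union> range f. m \<le> x"
proof (cases "\<forall>n. 0 \<le> f n")
  case True
  then show ?thesis
    by auto
next
  case False
  then obtain k where k: "f k < 0"
    by (auto simp: not_le)
  let ?A = "{n. f n \<le> f k}"
  have fin: "finite ?A"
    \<comment> \<open>From \<open>f n \<le> f k\<close> and \<open>f k < 0\<close> follows
      \<open>- f k \<le> \<bar>f n\<bar>\<close>.\<close>
    by (rule finite_subset[OF _ assms[of "- f k"]]) (use k in auto)
  define m where "m = Min (f ` ?A)"
  have "m \<in> f ` ?A"
    unfolding m_def using fin by (intro Min_in) auto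
  then have "m \<in> range f"
    by blast
  moreover have mk: "m \<le> f k"
    unfolding m_def using fin by (intro Min_le) auto
  moreover have "m \<le> f n" for n
  proof (cases "f n \<le> f k")
    case True
    then show ?thesis
      unfolding m_def using fin by (intro Min_le) auto
  next
    case False
    then show ?thesis
      using mk by linarith
  qed
  ultimately show ?thesis
    using less_imp_le[OF order.strict_trans1[OF mk k]] by (intro bexI[of _ m]) auto
qed

lemma omega_min_le:
  assumes "\<And>\<epsilon>. 0 < \<epsilon> \<Longrightarrow> finite {n. \<epsilon> \<le> \<bar>V n\<bar>}"
  shows "omega_min V \<le> V n"
proof -
  obtain m where m: "m \<in> {0} \<union> range V" "\<And>x. x \<in> {0} \<union> range V \<Longrightarrow> m \<le> x"
    using decaying_attains_min[OF assms] by blast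
  then have "omega_min V = m"
    unfolding omega_min_def by (rule Least_equality)
  then show ?thesis
    using m(2) by simp
qed

text \<open>The map taking \<open>x\<close> to \<open>4 - x\<close> turns this maximum into the
  minimum for \<open>- V\<close>.\<close>

lemma omega_max_ge:
  assumes "\<And>\<epsilon>. 0 < \<epsilon> \<Longrightarrow> finite {n. \<epsilon> \<le> \<bar>V n\<bar>}"
  shows "4 + V n \<le> omega_max V"
proof -
  obtain m where m: "m \<in> {0} \<union> range (\<lambda>n. - V n)"
    "\<And>x. x \<in> {0} \<union> range (\<lambda>n. - V n) \<Longrightarrow> m \<le> x"
    using decaying_attains_min[of "\<lambda>n. - V n", unfolded abs_minus_cancel, OF assms] by blast
  have "4 - m \<in> {4} \<union> range (\<lambda>n. 4 + V n)"
    using m(1) by auto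
  moreover have ge: "x \<le> 4 - m" if "x \<in> {4} \<union> range (\<lambda>n. 4 + V n)" for x
    using m(2)[of "4 - x"] that by auto
  ultimately have "omega_max V = 4 - m"
    unfolding omega_max_def by (rule Greatest_equality)
  then show ?thesis
    using ge by simp
qed

text \<open>The weight dominates both 1 and \<open>\<bar>n\<bar>\<close>. The plain sum yields
  boundedness and decay of \<open>V\<close>; the first moment feeds
  \<open>finite_dimensional_negative\<close>.\<close>

lemma weighted_l1_moment_summable:
  assumes "(\<lambda>n. complex_of_real (V n)) \<in> weighted_l1 s" and "1 \<le> s"
  shows "(\<lambda>n. \<bar>V n\<bar>) summable_on UNIV" "(\<lambda>n. \<bar>real_of_int n\<bar> * \<bar>V n\<bar>) summable_on UNIV"
proof -
  have s: "(\<lambda>n. (1 + (real_of_int n)\<^sup>2) powr (s / 2) * \<bar>V n\<bar>) summable_on UNIV"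
    using assms(1) by (simp add: weighted_l1_def)
  have weight: "1 \<le> (1 + y\<^sup>2) powr (s / 2)" "\<bar>y\<bar> \<le> (1 + y\<^sup>2) powr (s / 2)" for y :: real
  proof -
    show "1 \<le> (1 + y\<^sup>2) powr (s / 2)"
      using assms(2) by (intro ge_one_powr_ge_zero) auto
    have "\<bar>y\<bar> = sqrt (y\<^sup>2)"
      by simp
    also have "\<dots> \<le> sqrt (1 + y\<^sup>2)"
      by (intro real_sqrt_le_mono) simp
    also have "\<dots> = (1 + y\<^sup>2) powr (1 / 2)"
      by (rule powr_half_sqrt[symmetric]) simp
    also have "\<dots> \<le> (1 + y\<^sup>2) powr (s / 2)"
      using assms(2) by (intro powr_mono) auto
    finally show "\<bar>y\<bar> \<le> (1 + y\<^sup>2) powr (s / 2)" .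
  qed
  show "(\<lambda>n. \<bar>V n\<bar>) summable_on UNIV"
    by (rule summable_on_comparison_test[OF s])
      (use mult_right_mono[OF weight(1), of "\<bar>V _\<bar>"] in auto)
  show "(\<lambda>n. \<bar>real_of_int n\<bar> * \<bar>V n\<bar>) summable_on UNIV"
    by (rule summable_on_comparison_test[OF s]) (auto intro: mult_right_mono weight(2))
qed

theorem lemma1:
  fixes \<sigma> :: real and V :: "int \<Rightarrow> real"
  assumes "\<sigma> > 5/2"
    and "(\<lambda>n. complex_of_real (V n)) \<in> weighted_l1 (2 * \<sigma> - 1)"
    and "generic_potential V"
  defines "H \<equiv> schroedinger V"
  shows "finite (discrete_spectrum H)
    \<and> (\<forall>z\<in>discrete_spectrum H. is_eigenvalue H z \<and> finite_dimensional (eigenspace H z))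
    \<and> finite_dimensional (cseq.span (\<Union>z\<in>discrete_spectrum H. eigenspace H z))
    \<and> discrete_spectrum H \<subseteq>
        complex_of_real ` ({omega_min V<..<0} \<union> {4<..<omega_max V})"
proof -
  have sum: "(\<lambda>n. \<bar>V n\<bar>) summable_on UNIV" "(\<lambda>n. \<bar>real_of_int n\<bar> * \<bar>V n\<bar>) summable_on UNIV"
    using weighted_l1_moment_summable[OF assms(2)] assms(1) by simp_all
  have decay: "finite {n. \<epsilon> \<le> \<bar>V n\<bar>}" if "0 < \<epsilon>" for \<epsilon>
    using summable_on_finite_superlevel[OF sum(1) _ that] by simp
  have bd: "bounded (range V)"
  proof -
    have "\<bar>V n\<bar> \<le> (\<Sum>\<^sub>\<infinity>n. \<bar>V n\<bar>)" for n
      using finite_sum_le_infsum[OF sum(1), of "{n}"] by simp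
    then show ?thesis
      unfolding bounded_iff by (auto simp: real_norm_def)
  qed
  have bd': "bounded (range (\<lambda>n. - V n))"
    using bd unfolding bounded_iff by auto
  \<comment> \<open>The potential is a parameter because \<open>V\<close> accounts for the part
    below 0 and \<open>- V\<close> for the part above 4. Isolation of the eigenvalues is left out of
    the definition.\<close>
  define N where "N W = {x. x < 0 \<and> is_eigenvalue (schroedinger W) (complex_of_real x)}" for W
  define E where "E W = cseq.span (\<Union>x\<in>N W. eigenspace (schroedinger W) (complex_of_real x))" for W
  have fdE: "finite_dimensional (E V)" "finite_dimensional (E (\<lambda>n. - V n))"
    unfolding E_def by (rule finite_dimensional_negative; use bd bd' sum in \<open>auto simp: N_def\<close>)+
  have finN: "finite (N V)" "finite (N (\<lambda>n. - V n))"
    using finite_eigenvalues[OF bd _ fdE(1)[unfolded E_def]]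
      finite_eigenvalues[OF bd' _ fdE(2)[unfolded E_def]]
    by (auto simp: N_def)
  have cases: "\<exists>x. z = complex_of_real x \<and> (omega_min V < x \<and> x < 0 \<and> x \<in> N V
      \<or> 4 < x \<and> x < omega_max V \<and> 4 - x \<in> N (\<lambda>n. - V n))"
    if z: "z \<in> discrete_spectrum H" for z
  proof -
    have ev: "is_eigenvalue (schroedinger V) z" and iso: "z isolated_in spectrum (schroedinger V)"
      using z by (auto simp: discrete_spectrum_def H_def)
    define x where "x = Re z"
    have zx: "z = complex_of_real x"
      using eigenvalue_real[OF bd ev] by (simp add: x_def)
    have ev': "is_eigenvalue (schroedinger (\<lambda>n. - V n)) (complex_of_real (4 - x))"
      using is_eigenvalue_flip[OF ev] by (simp add: zx)
    have "omega_min V < x"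
      using eigenvalue_gt[OF bd ev omega_min_le[OF decay]] by (simp add: x_def)
    \<comment> \<open>The upper bound at \<open>x\<close> is the lower bound for the reflected
      eigenvalue \<open>4 - x\<close>, since \<open>4 - omega_max V\<close> bounds
      \<open>- V\<close> from below.\<close>
    moreover have "4 - omega_max V < 4 - x"
      using eigenvalue_gt[OF bd' ev', of "4 - omega_max V"] omega_max_ge[OF decay]
      by (simp add: algebra_simps)
    moreover have "x < 0 \<or> 4 < x"
      using not_isolated_in_interval[of "spectrum (schroedinger V)" x]
        continuous_spectrum_subset[OF decay] iso
      unfolding zx by fastforce
    ultimately show ?thesis
      using zx ev ev' by (intro exI[of _ x]) (auto simp: N_def)
  qed
  have "discrete_spectrum H \<subseteq> complex_of_real ` N V
      \<union> (\<lambda>x. complex_of_real (4 - x)) ` N (\<lambda>n. - V n)"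
  proof
    fix z assume "z \<in> discrete_spectrum H"
    from cases[OF this] obtain x where "z = complex_of_real x"
      "x \<in> N V \<or> 4 - x \<in> N (\<lambda>n. - V n)"
      by blast
    then show "z \<in> complex_of_real ` N V
      \<union> (\<lambda>x. complex_of_real (4 - x)) ` N (\<lambda>n. - V n)"
      by (force intro: image_eqI[of _ _ "4 - x"])
  qed
  then have "finite (discrete_spectrum H)"
    using finN by (auto intro: finite_subset)
  moreover have "finite_dimensional (cseq.span (\<Union>z\<in>discrete_spectrum H. eigenspace H z))"
  proof (rule finite_dimensional_span_Un[OF fdE(1) finite_dimensional_flip[OF fdE(2)]])
    show "(\<Union>z\<in>discrete_spectrum H. eigenspace H z) \<subseteq> E V \<union> flip ` E (\<lambda>n. - V n)"
    proof
      fix u assume "u \<in> (\<Union>z\<in>discrete_spectrum H. eigenspace H z)"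
      then obtain z where z: "z \<in> discrete_spectrum H" "u \<in> eigenspace (schroedinger V) z"
        by (auto simp: H_def)
      from cases[OF z(1)] obtain x where x: "z = complex_of_real x"
        "x \<in> N V \<or> 4 - x \<in> N (\<lambda>n. - V n)"
        by blast
      from x(2) show "u \<in> E V \<union> flip ` E (\<lambda>n. - V n)"
      proof
        assume "x \<in> N V"
        then have "u \<in> E V"
          using z(2) unfolding E_def x(1) by (blast intro: cseq.span_base)
        then show ?thesis ..
      next
        assume "4 - x \<in> N (\<lambda>n. - V n)"
        \<comment> \<open>Eigenvectors above 4 are reflected to the negative side, and the
          involution \<open>flip\<close> brings them back.\<close>
        moreover have "flip u \<in> eigenspace (schroedinger (\<lambda>n. - V n)) (complex_of_real (4 - x))"
          using flip_eigenspace[OF z(2)] by (simp add: x(1))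
        ultimately have "flip u \<in> E (\<lambda>n. - V n)"
          unfolding E_def by (blast intro: cseq.span_base)
        then have "u \<in> flip ` E (\<lambda>n. - V n)"
          using flip_flip[of u] by (metis image_eqI)
        then show ?thesis ..
      qed
    qed
  qed
  moreover have "discrete_spectrum H \<subseteq>
      complex_of_real ` ({omega_min V<..<0} \<union> {4<..<omega_max V})"
    using cases by fastforce
  ultimately show ?thesis
    by (auto simp: discrete_spectrum_def)
qed

end
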